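(* Let $F\in\mathcal{H}^d$, $\mathbf{x}^0\in\mathcal{S}_{++}$ and $A=\mathcal{A}(F)$. Suppose that $\rho(A)=1$ and there exists $(\boldsymbol{\lambda},\mathbf{u})\in\mathbb{R}^d_{++}\times\mathcal{S}_{++}$ such that $F(\mathbf{u})=\boldsymbol{\lambda}\otimes\mathbf{u}$. If $F$ is differentiable at $\mathbf{u}$ and $DF(\mathbf{u})$ is primitive, then $\mathbf{u}$ is the unique eigenvector of $F$ in $\mathcal{S}_{++}$ and the sequence $(\mathbf{x}^k)_{k=0}^\infty\subset\mathcal{S}_{++}$ defined by $$\mathbf{x}^k=\left(\frac{F_1(\mathbf{x}^{k-1})}{\|F_1(\mathbf{x}^{k-1})\|_{\gamma_1}},\ldots,\frac{F_d(\mathbf{x}^{k-1})}{\|F_d(\mathbf{x}^{k-1})\|_{\gamma_d}}\right),\qquad k=1,2,\ldots,$$ satisfies $\lim_{k\to\infty}\mathbf{x}^k=\mathbf{u}$.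
   Context: $\rho$ is the spectral radius. Fix positive integers $d,n_1,\ldots,n_d$. Let $\mathcal{K}_+=\mathbb{R}^{n_1}_+\times\cdots\times\mathbb{R}^{n_d}_+$ (nonnegative entries), $\mathcal{K}_{++}=\mathbb{R}^{n_1}_{++}\times\cdots\times\mathbb{R}^{n_d}_{++}$ (positive entries). Write $\mathbf{x}=(\mathbf{x}_1,\ldots,\mathbf{x}_d)$ with $\mathbf{x}_i\in\mathbb{R}^{n_i}$ and $F=(F_1,\ldots,F_d)$. $\mathbf{x}\le\mathbf{y}$ means $\mathbf{y}-\mathbf{x}\in\mathcal{K}_+$. For $\boldsymbol{\alpha}\in\mathbb{R}^d$, $\boldsymbol{\alpha}\otimes\mathbf{x}=(\alpha_1\mathbf{x}_1,\ldots,\alpha_d\mathbf{x}_d)$. For $\boldsymbol{\alpha}\in\mathbb{R}^d_{++}$ and $B\in\mathbb{R}^{d\times d}$, $\boldsymbol{\alpha}^B=(\prod_{k}\alpha_k^{B_{1,k}},\ldots,\prod_k\alpha_k^{B_{d,k}})$. $\mathbf{1}$ is the vector of all ones. $DF(\mathbf{u})$ is the Jacobian matrix of $F$ at $\mathbf{u}$. A nonnegative square matrix $M$ is primitive if $M^\nu$ has positive entries for some positive integer $\nu$. $F\colon\mathcal{K}_+\to\mathcal{K}_+$ is order-preserving if $\mathbf{x}\le\mathbf{y}$ implies $F(\mathbf{x})\le F(\mathbf{y})$; it is multi-homogeneous with homogeneity matrix $\mathcal{A}(F)=A\in\mathbb{R}^{d\times d}$ if $F(\boldsymbol{\alpha}\otimes\mathbf{x})=\boldsymbol{\alpha}^A\otimes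 F(\mathbf{x})$ for all $\mathbf{x}\in\mathcal{K}_+$, $\boldsymbol{\alpha}\in\mathbb{R}^d_{++}$. $\mathcal{H}^d$ is the set of $F\colon\mathcal{K}_+\to\mathcal{K}_+$ that are continuous, order-preserving and multi-homogeneous, with $F(\mathbf{1})\in\mathcal{K}_{++}$ and such that $\mathcal{A}(F)$ has at least one nonzero entry per row. An eigenvector of $F$ is $\mathbf{x}$ with $\mathbf{x}_i\neq0$ for all $i$ and $F(\mathbf{x})=\boldsymbol{\theta}\otimes\mathbf{x}$ for some $\boldsymbol{\theta}\in\mathbb{R}^d$. For each $i$, $\|\cdot\|_{\gamma_i}$ is a norm on $\mathbb{R}^{n_i}$, assumed monotonic ($0\le\mathbf{x}_i\le\mathbf{y}_i$ implies $\|\mathbf{x}_i\|_{\gamma_i}\le\|\mathbf{y}_i\|_{\gamma_i}$); $\mathcal{S}_{++}=\{\mathbf{x}\in\mathcal{K}_{++}:\|\mathbf{x}_i\|_{\gamma_i}=1,\ i=1,\ldots,d\}$. *)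

theory Defs
  imports "HOL-Analysis.Analysis"
begin

text \<open>
  The product \<open>R^n_1 \<times> \<dots> \<times> R^n_d\<close> is represented as \<open>real^'n\<close>, where the coordinates are
  partitioned by a surjection \<open>blk :: 'n \<Rightarrow> 'd\<close>: coordinate \<open>j\<close> belongs to the factor \<open>blk j\<close>.
  Thus \<open>d = CARD('d)\<close> and \<open>n_i = card (blk -` {i})\<close>, and surjectivity says that every \<open>n_i\<close>
  is positive.  The factor \<open>R^n_i\<close> is identified with the coordinate subspace
  \<open>block_space blk i\<close>, and the component \<open>x_i\<close> of \<open>x\<close> with \<open>block blk i x\<close>.
\<close>

definition block_space :: "('n::finite \<Rightarrow> 'd::finite) \<Rightarrow> 'd \<Rightarrow> (real^'n) set" where
  "block_space blk i = {v. \<forall>j. blk j \<noteq> i \<longrightarrow> v $ j = 0}"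

definition block :: "('n::finite \<Rightarrow> 'd::finite) \<Rightarrow> 'd \<Rightarrow> real^'n \<Rightarrow> real^'n" where
  "block blk i x = (\<chi> j. if blk j = i then x $ j else 0)"

definition K_plus :: "(real^'n::finite) set" where
  "K_plus = {x. \<forall>j. 0 \<le> x $ j}"

definition K_pplus :: "(real^'n::finite) set" where
  "K_pplus = {x. \<forall>j. 0 < x $ j}"

definition block_scale :: "('n::finite \<Rightarrow> 'd::finite) \<Rightarrow> real^'d \<Rightarrow> real^'n \<Rightarrow> real^'n" where
  "block_scale blk \<alpha> x = (\<chi> j. \<alpha> $ blk j * x $ j)"

definition vec_powr :: "real^'d::finite \<Rightarrow> real^'d^'d \<Rightarrow> real^'d" where
  "vec_powr \<alpha> B = (\<chi> i. \<Prod>k\<in>UNIV. (\<alpha> $ k) powr (B $ i $ k))"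

definition multi_homogeneous ::
  "('n::finite \<Rightarrow> 'd::finite) \<Rightarrow> (real^'n \<Rightarrow> real^'n) \<Rightarrow> real^'d^'d \<Rightarrow> bool" where
  "multi_homogeneous blk F A \<longleftrightarrow>
     (\<forall>x\<in>K_plus. \<forall>\<alpha>. (\<forall>i. 0 < \<alpha> $ i) \<longrightarrow>
        F (block_scale blk \<alpha> x) = block_scale blk (vec_powr \<alpha> A) (F x))"

text \<open>
  The class \<open>H^d\<close>.  Functions are total on \<open>real^'n\<close>, but only their values on \<open>K_plus\<close> are
  constrained.  When \<open>blk\<close> is surjective, \<open>F 1 \<in> K_pplus\<close> makes the homogeneity matrix \<open>A\<close> unique.
\<close>

definition H_class :: "('n::finite \<Rightarrow> 'd::finite) \<Rightarrow> (real^'n \<Rightarrow> real^'n) set" where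
  "H_class blk = {F. F \<in> K_plus \<rightarrow> K_plus \<and> continuous_on K_plus F
     \<and> (\<forall>x\<in>K_plus. \<forall>y\<in>K_plus. x \<le> y \<longrightarrow> F x \<le> F y)
     \<and> F 1 \<in> K_pplus
     \<and> (\<exists>A. multi_homogeneous blk F A \<and> (\<forall>i. \<exists>k. A $ i $ k \<noteq> 0))}"

definition mh_eigenvector ::
  "('n::finite \<Rightarrow> 'd::finite) \<Rightarrow> (real^'n \<Rightarrow> real^'n) \<Rightarrow> real^'n \<Rightarrow> bool" where
  "mh_eigenvector blk F x \<longleftrightarrow>
     x \<in> K_plus \<and> (\<forall>i. block blk i x \<noteq> 0) \<and> (\<exists>\<theta>. F x = block_scale blk \<theta> x)"

definition norm_on :: "(real^'n::finite) set \<Rightarrow> (real^'n \<Rightarrow> real) \<Rightarrow> bool" where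
  "norm_on V N \<longleftrightarrow>
     (\<forall>v\<in>V. 0 \<le> N v \<and> (N v = 0 \<longleftrightarrow> v = 0)) \<and>
     (\<forall>c. \<forall>v\<in>V. N (c *\<^sub>R v) = \<bar>c\<bar> * N v) \<and>
     (\<forall>v\<in>V. \<forall>w\<in>V. N (v + w) \<le> N v + N w)"

definition monotonic_norm_on :: "(real^'n::finite) set \<Rightarrow> (real^'n \<Rightarrow> real) \<Rightarrow> bool" where
  "monotonic_norm_on V N \<longleftrightarrow>
     norm_on V N \<and> (\<forall>v\<in>V. \<forall>w\<in>V. 0 \<le> v \<and> v \<le> w \<longrightarrow> N v \<le> N w)"

definition S_pplus ::
  "('n::finite \<Rightarrow> 'd::finite) \<Rightarrow> ('d \<Rightarrow> real^'n \<Rightarrow> real) \<Rightarrow> (real^'n) set" where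
  "S_pplus blk \<gamma> = {x \<in> K_pplus. \<forall>i. \<gamma> i (block blk i x) = 1}"

definition block_normalize ::
  "('n::finite \<Rightarrow> 'd::finite) \<Rightarrow> ('d \<Rightarrow> real^'n \<Rightarrow> real) \<Rightarrow> real^'n \<Rightarrow> real^'n" where
  "block_normalize blk \<gamma> x = (\<chi> j. x $ j / \<gamma> (blk j) (block blk (blk j) x))"

text \<open>Complex eigenvalues are needed here even though the matrix is real.\<close>

definition complex_spectrum :: "real^'d^'d::finite \<Rightarrow> complex set" where
  "complex_spectrum A =
     {z. \<exists>v. v \<noteq> 0 \<and> map_matrix complex_of_real A *v v = z *s v}"

definition spectral_radius :: "real^'d^'d::finite \<Rightarrow> real" where
  "spectral_radius A = (SUP z\<in>complex_spectrum A. cmod z)"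

definition primitive_matrix :: "real^'n^'n::finite \<Rightarrow> bool" where
  "primitive_matrix M \<longleftrightarrow>
     (\<forall>i j. 0 \<le> M $ i $ j) \<and>
     (\<exists>\<nu>::nat. 0 < \<nu> \<and> (\<forall>i j. 0 < (((**) M ^^ \<nu>) (mat 1)) $ i $ j))"

end

theory Submission
  imports Defs
begin

text \<open>
  Divide out the eigenvector and pass to logarithms: with \<open>x = u exp z\<close> (componentwise) the map \<open>F\<close>
  becomes \<open>G z = ln (F (u exp z) / F u)\<close> on all of \<open>real^'n\<close>.  It is order-preserving, fixes \<open>0\<close>, and
  multi-homogeneity turns into \<open>G (z + lift \<beta>) = G z + lift (A \<beta>)\<close>, where \<open>lift\<close> spreads a vector
  indexed by blocks over the coordinates.

  The derivative \<open>N\<close> of \<open>G\<close> at \<open>0\<close> is \<open>DF u\<close> scaled by positive diagonal matrices on both sides, so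
  it is primitive as well.  Differentiating the homogeneity relation gives \<open>N (lift \<beta>) = lift (A \<beta>)\<close>:
  the matrix \<open>A\<close> is a quotient of \<open>N\<close>.  This forces \<open>A\<close> to be nonnegative, and a nonnegative
  eigenvector \<open>v\<close> of \<open>A\<close>, which exists by Brouwer's theorem, must be positive because \<open>lift v\<close> is an
  eigenvector of a positive power of \<open>N\<close>.  A positive eigenvector belongs to the spectral radius, so
  \<open>A v = v\<close> (lemma \<open>quotient_positive_fixed_vector\<close>).

  With \<open>w = lift v\<close> the block structure disappears: \<open>G\<close> is monotone and commutes with translations
  along the single positive direction \<open>w\<close>, hence the largest ratio \<open>z_j / w_j\<close> cannot increase along an
  orbit, and the smallest cannot decrease.  Primitivity of the derivative makes some iterate of \<open>G\<close>
  decrease the largest ratio strictly away from the line spanned by \<open>w\<close>, and then compactness gives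
  \<open>G^k z \<longlonglongrightarrow> c w\<close> (lemma \<open>topical_iterates_converge\<close>).

  Normalization of the blocks commutes with the iteration up to positive factors on the blocks, so
  \<open>x k\<close> is the normalization of \<open>u exp (G^k z)\<close>.  Its limit is the normalization of
  \<open>u exp (c lift v)\<close>, a vector that differs from \<open>u\<close> by block factors only, hence \<open>u\<close> itself.
  Uniqueness of the eigenvector is a consequence: an eigenvector in the unit sphere is a constant
  orbit of the normalized iteration, and this orbit converges to \<open>u\<close>.
\<close>

section \<open>Iterates of monotone maps that commute with translations along a line\<close>

definition top_ratio :: "real^'n::finite \<Rightarrow> real^'n \<Rightarrow> real" where
  "top_ratio w z = Max (range (\<lambda>j. z $ j / w $ j))"

lemma top_ratio_le_iff:
  fixes w z :: "real^'n::finite"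
  assumes "\<And>j. 0 < w $ j"
  shows "top_ratio w z \<le> c \<longleftrightarrow> z \<le> c *\<^sub>R w"
  using assms by (simp add: top_ratio_def less_eq_vec_def pos_divide_le_eq)

lemma top_ratio_less_iff:
  fixes w z :: "real^'n::finite"
  assumes "\<And>j. 0 < w $ j"
  shows "top_ratio w z < c \<longleftrightarrow> (\<forall>j. z $ j < c * w $ j)"
  using assms by (simp add: top_ratio_def pos_divide_less_eq)

lemma top_ratio_scaleR:
  fixes w :: "real^'n::finite"
  assumes "\<And>j. 0 < w $ j"
  shows "top_ratio w (c *\<^sub>R w) = c"
proof -
  have "w $ j \<noteq> 0" for j
    using assms[of j] by simp
  then show ?thesis
    by (simp add: top_ratio_def)
qed

text \<open>
  Being a maximum of linear functionals, the ratio is convex, and convex functions on an open set of a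
  Euclidean space are continuous.
\<close>

lemma continuous_top_ratio:
  fixes w :: "real^'n::finite"
  assumes w: "\<And>j. 0 < w $ j"
  shows "continuous_on UNIV (top_ratio w)"
proof (rule convex_on_continuous)
  show "convex_on UNIV (top_ratio w)"
  proof (intro convex_onI)
    fix t :: real and x y :: "real^'n"
    assume t: "0 < t" "t < 1"
    have x: "x \<le> top_ratio w x *\<^sub>R w" and y: "y \<le> top_ratio w y *\<^sub>R w"
      by (simp_all flip: top_ratio_le_iff[OF w])
    have "(1 - t) *\<^sub>R x + t *\<^sub>R y
        \<le> (1 - t) *\<^sub>R (top_ratio w x *\<^sub>R w) + t *\<^sub>R (top_ratio w y *\<^sub>R w)"
      using t x y by (intro add_mono scaleR_left_mono) auto
    then show "top_ratio w ((1 - t) *\<^sub>R x + t *\<^sub>R y)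
        \<le> (1 - t) * top_ratio w x + t * top_ratio w y"
      by (simp add: top_ratio_le_iff[OF w] scaleR_add_left)
  qed simp
qed simp

text \<open>
  Since \<open>p \<le> t w\<close> with strict inequality in some coordinate \<open>j\<close>, also \<open>p \<le> t w - h e_j\<close> for small \<open>h > 0\<close>.
  Monotonicity and translation invariance give \<open>H p \<le> t w + H (- h e_j)\<close>, and the positive derivative
  makes every coordinate of \<open>H (- h e_j)\<close> negative.
\<close>

lemma top_ratio_less:
  fixes H :: "real^'n::finite \<Rightarrow> real^'n" and w :: "real^'n"
  assumes w: "\<And>j. 0 < w $ j"
    and mono: "mono H"
    and hom: "\<And>z c. H (z + c *\<^sub>R w) = H z + c *\<^sub>R w"
    and zero: "H 0 = 0"
    and deriv: "(H has_derivative L) (at 0)"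
    and pos: "\<And>i j. 0 < L (axis j 1) $ i"
    and p: "p \<noteq> top_ratio w p *\<^sub>R w"
  shows "top_ratio w (H p) < top_ratio w p"
proof -
  define t where "t = top_ratio w p"
  have le: "p \<le> t *\<^sub>R w"
    by (simp add: t_def flip: top_ratio_le_iff[OF w])
  with p obtain j where j: "p $ j < t * w $ j"
    unfolding t_def[symmetric] vec_eq_iff less_eq_vec_def
    by (force simp: le_less)
  have "H p $ i < t * w $ i" for i
  proof -
    have "((\<lambda>h. H (h *\<^sub>R axis j 1) $ i) has_derivative (\<lambda>h. L (h *\<^sub>R axis j 1) $ i)) (at (0::real))"
    proof -
      have "((\<lambda>h::real. h *\<^sub>R axis j 1) has_derivative (\<lambda>h. h *\<^sub>R axis j 1)) (at 0)"
        by (rule bounded_linear_imp_has_derivative[OF bounded_linear_scaleR_left])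
      moreover have "(H has_derivative L) (at ((0::real) *\<^sub>R axis j 1))"
        using deriv by simp
      ultimately show ?thesis
        by (rule bounded_linear.has_derivative[OF bounded_linear_vec_nth has_derivative_compose])
    qed
    moreover have "(\<lambda>h. L (h *\<^sub>R axis j 1) $ i) = (*) (L (axis j 1) $ i)"
      using has_derivative_linear[OF deriv] by (simp add: linear_cmul fun_eq_iff)
    ultimately have "DERIV (\<lambda>h. H (h *\<^sub>R axis j 1) $ i) 0 :> L (axis j 1) $ i"
      by (simp add: has_field_derivative_def)
    from DERIV_pos_inc_left[OF this pos] obtain d where d: "d > 0"
      "\<And>h. \<lbrakk>0 < h; h < d\<rbrakk> \<Longrightarrow> H ((- h) *\<^sub>R axis j 1) $ i < 0"
      using zero by auto
    define h where "h = min (d / 2) (t * w $ j - p $ j)"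
    have h: "0 < h" "h < d" "h \<le> t * w $ j - p $ j"
      using d(1) j by (auto simp: h_def)
    have "p \<le> (- h) *\<^sub>R axis j 1 + t *\<^sub>R w"
      using le h(3) by (auto simp: less_eq_vec_def axis_def)
    then have "H p \<le> H ((- h) *\<^sub>R axis j 1) + t *\<^sub>R w"
      using monoD[OF mono] hom by metis
    then show ?thesis
      using d(2)[OF h(1,2)] by (force simp: less_eq_vec_def dest: spec[of _ i])
  qed
  then show ?thesis
    by (simp add: top_ratio_less_iff[OF w] t_def)
qed

lemma funpow_has_derivative_at_fixpoint:
  fixes G :: "'a::real_normed_vector \<Rightarrow> 'a"
  assumes "(G has_derivative L) (at a)" and "G a = a"
  shows "((G ^^ n) has_derivative (L ^^ n)) (at a)"
proof (induction n)
  case 0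
  show ?case by (simp add: id_def)
next
  case (Suc n)
  have "(G ^^ n) a = a"
    using assms(2) by (induction n) auto
  then show ?case
    using diff_chain_at[OF Suc.IH, of G L] assms(1) by (simp add: o_def)
qed

text \<open>
  The largest ratio \<open>T k\<close> along the orbit decreases to a limit \<open>\<tau>\<close>, and the orbit stays in an order
  interval.  At a limit point \<open>p\<close>, continuity makes the largest ratio of both \<open>p\<close> and \<open>G^\<nu> p\<close> equal to
  \<open>\<tau>\<close>, so strict decrease is impossible and \<open>p = \<tau> w\<close>.  Then the smallest ratio tends to \<open>\<tau>\<close> along a
  subsequence, hence along the whole sequence by monotonicity, and the orbit is squeezed.
\<close>

lemma topical_iterates_converge:
  fixes G :: "real^'n::finite \<Rightarrow> real^'n" and w z :: "real^'n"
  assumes w: "\<And>j. 0 < w $ j"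
    and mono: "mono G"
    and hom: "\<And>z c. G (z + c *\<^sub>R w) = G z + c *\<^sub>R w"
    and zero: "G 0 = 0"
    and cont: "continuous_on UNIV G"
    and deriv: "(G has_derivative L) (at 0)"
    and pos: "\<And>i j. 0 < (L ^^ \<nu>) (axis j 1) $ i"
  shows "\<exists>c. (\<lambda>k. (G ^^ k) z) \<longlonglongrightarrow> c *\<^sub>R w"
proof -
  define y where "y k = (G ^^ k) z" for k
  define T where "T k = top_ratio w (y k)" for k
  \<comment> \<open>The smallest ratio of \<open>y k\<close> is encoded as \<open>- B k\<close>.\<close>
  define B where "B k = top_ratio w (- y k)" for k
  have G_ray: "G (c *\<^sub>R w) = c *\<^sub>R w" for c
    using hom[of 0 c] zero by simp
  have y_le: "y k \<le> T k *\<^sub>R w" and y_ge: "(- B k) *\<^sub>R w \<le> y k" for k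
  proof -
    show "y k \<le> T k *\<^sub>R w"
      by (simp add: T_def flip: top_ratio_le_iff[OF w])
    have "- y k \<le> B k *\<^sub>R w"
      by (simp add: B_def flip: top_ratio_le_iff[OF w])
    then show "(- B k) *\<^sub>R w \<le> y k"
      by (simp add: minus_le_iff)
  qed
  have "T (Suc k) \<le> T k" for k
  proof -
    have "y (Suc k) \<le> T k *\<^sub>R w"
      using monoD[OF mono y_le[of k]] by (simp add: y_def G_ray)
    then show ?thesis
      by (simp add: T_def top_ratio_le_iff[OF w])
  qed
  then have T_dec: "decseq T"
    by (simp add: decseq_Suc_iff)
  have "B (Suc k) \<le> B k" for k
  proof -
    have "(- B k) *\<^sub>R w \<le> y (Suc k)"
      using monoD[OF mono y_ge[of k]] G_ray[of "- B k"] by (simp add: y_def)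
    then show ?thesis
      by (simp add: B_def top_ratio_le_iff[OF w] minus_le_iff)
  qed
  then have B_dec: "decseq B"
    by (simp add: decseq_Suc_iff)
  have TB: "- B k \<le> T k" for k
  proof -
    have "(- B k) *\<^sub>R w \<le> T k *\<^sub>R w"
      by (rule order_trans[OF y_ge y_le])
    then have "- B k * w $ i \<le> T k * w $ i" for i
      by (simp add: less_eq_vec_def)
    then show ?thesis
      by (rule mult_right_le_imp_le[OF _ w])
  qed
  have TB': "- B 0 \<le> T k" "- T 0 \<le> B k" for k
    using TB[of k] decseqD[OF T_dec, of 0 k] decseqD[OF B_dec, of 0 k] by auto
  obtain \<tau> where \<tau>: "T \<longlonglongrightarrow> \<tau>"
    using decseq_convergent[OF T_dec allI[OF TB'(1)]] by blast
  obtain \<beta> where \<beta>: "B \<longlonglongrightarrow> \<beta>"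
    using decseq_convergent[OF B_dec allI[OF TB'(2)]] by blast
  have "y k \<in> cbox ((- B 0) *\<^sub>R w) (T 0 *\<^sub>R w)" for k
  proof -
    have "T k *\<^sub>R w \<le> T 0 *\<^sub>R w" "(- B 0) *\<^sub>R w \<le> (- B k) *\<^sub>R w"
      using decseqD[OF T_dec, of 0 k] decseqD[OF B_dec, of 0 k] w
      by (auto simp: less_eq_vec_def intro!: mult_right_mono less_imp_le)
    then show ?thesis
      using order_trans[OF y_le[of k]] order_trans[OF _ y_ge[of k]]
      by (simp add: cbox_interval)
  qed
  then have "bounded (range y)"
    by (intro bounded_subset[OF bounded_cbox]) auto
  from bounded_imp_convergent_subsequence[OF this]
  obtain p r where r: "strict_mono (r :: nat \<Rightarrow> nat)" and p: "(y \<circ> r) \<longlonglongrightarrow> p"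
    by blast
  have top_lim: "(\<lambda>k. top_ratio w (f k)) \<longlonglongrightarrow> top_ratio w q" if "f \<longlonglongrightarrow> q" for f q
    using continuous_on_tendsto_compose[OF continuous_top_ratio[OF w] that] by simp
  have cont_pow: "continuous_on UNIV (G ^^ n)" for n
  proof (induction n)
    case (Suc n)
    show ?case
      using continuous_on_compose[OF Suc.IH continuous_on_subset[OF cont]] by simp
  qed (simp add: id_def)
  have "(\<lambda>m. top_ratio w ((y \<circ> r) m)) \<longlonglongrightarrow> \<tau>"
    using LIMSEQ_subseq_LIMSEQ[OF \<tau> r] by (simp add: T_def o_def)
  then have top_p: "top_ratio w p = \<tau>"
    using LIMSEQ_unique[OF top_lim[OF p]] by blast
  have shift: "y (r m + \<nu>) = (G ^^ \<nu>) (y (r m))" for m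
    by (metis y_def add.commute comp_apply funpow_add)
  have "(\<lambda>m. y (r m + \<nu>)) \<longlonglongrightarrow> (G ^^ \<nu>) p"
    unfolding shift using continuous_on_tendsto_compose[OF cont_pow p] by simp
  then have "(\<lambda>m. T (r m + \<nu>)) \<longlonglongrightarrow> top_ratio w ((G ^^ \<nu>) p)"
    unfolding T_def by (rule top_lim)
  moreover have "(\<lambda>m. T (r m + \<nu>)) \<longlonglongrightarrow> \<tau>"
    using LIMSEQ_subseq_LIMSEQ[OF LIMSEQ_ignore_initial_segment[OF \<tau>, of \<nu>] r]
    by (simp add: o_def)
  ultimately have top_pow: "top_ratio w ((G ^^ \<nu>) p) = \<tau>"
    using LIMSEQ_unique by blast
  have pow: "(G ^^ n) (q + c *\<^sub>R w) = (G ^^ n) q + c *\<^sub>R w" "(G ^^ n) 0 = 0" for n q c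
    using hom zero by (induction n) auto
  have "p = \<tau> *\<^sub>R w"
    using top_ratio_less[OF w mono_pow[OF mono] pow
        funpow_has_derivative_at_fixpoint[OF deriv zero] pos] top_p top_pow
    by (metis less_irrefl)
  then have "(\<lambda>m. top_ratio w (- (y \<circ> r) m)) \<longlonglongrightarrow> - \<tau>"
    using top_lim[OF tendsto_minus[OF p]] top_ratio_scaleR[OF w, of "- \<tau>"] by simp
  then have \<beta>_eq: "\<beta> = - \<tau>"
    using LIMSEQ_unique[OF LIMSEQ_subseq_LIMSEQ[OF \<beta> r]] by (simp add: B_def o_def)
  have "y \<longlonglongrightarrow> \<tau> *\<^sub>R w"
  proof (rule vec_tendstoI)
    fix i
    have "(- B k) * w $ i \<le> y k $ i" "y k $ i \<le> T k * w $ i" for k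
      using y_ge[of k] y_le[of k] by (simp_all add: less_eq_vec_def)
    moreover have "(\<lambda>k. (- B k) * w $ i) \<longlonglongrightarrow> \<tau> * w $ i"
      using tendsto_mult_right[OF tendsto_minus[OF \<beta>], of "w $ i"] by (simp add: \<beta>_eq)
    moreover have "(\<lambda>k. T k * w $ i) \<longlonglongrightarrow> \<tau> * w $ i"
      by (rule tendsto_mult_right[OF \<tau>])
    ultimately have "(\<lambda>k. y k $ i) \<longlonglongrightarrow> \<tau> * w $ i"
      by (rule tendsto_sandwich[OF always_eventually[OF allI] always_eventually[OF allI]])
    then show "(\<lambda>k. y k $ i) \<longlonglongrightarrow> (\<tau> *\<^sub>R w) $ i"
      by simp
  qed
  then show ?thesis
    unfolding y_def by blast
qed

section \<open>Perron vectors\<close>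

text \<open>
  Brouwer's theorem on the standard simplex.  Normalizing \<open>v + A v\<close> instead of \<open>A v\<close> keeps the
  denominator at least \<open>1\<close>, even when \<open>A v = 0\<close>; the matrices \<open>I + A\<close> and \<open>A\<close> have the same
  eigenvectors.
\<close>

lemma nonneg_matrix_eigenvector:
  fixes A :: "real^'d^'d::finite"
  assumes A: "\<And>i k. 0 \<le> A $ i $ k"
  obtains v \<mu> where "\<And>i. 0 \<le> v $ i" "v \<noteq> 0" "0 \<le> \<mu>" "A *v v = \<mu> *\<^sub>R v"
proof -
  define S :: "(real^'d) set" where "S = {v. (\<forall>i. 0 \<le> v $ i) \<and> (\<Sum>i\<in>UNIV. v $ i) = 1}"
  define s where "s v = (\<Sum>i\<in>UNIV. (v + A *v v) $ i)" for v
  define f where "f v = (1 / s v) *\<^sub>R (v + A *v v)" for v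
  have Av: "0 \<le> (A *v v) $ i" if "v \<in> S" for v i
    using that A by (auto simp: S_def matrix_vector_mult_def intro!: sum_nonneg)
  have s: "1 \<le> s v" if "v \<in> S" for v
    using that Av[OF that] by (auto simp: s_def S_def sum.distrib intro!: sum_nonneg)
  have "compact S"
  proof -
    have "S \<subseteq> cbox 0 1"
    proof
      fix v assume v: "v \<in> S"
      then have "v $ i \<le> (\<Sum>i\<in>UNIV. v $ i)" for i
        by (intro member_le_sum) (auto simp: S_def)
      with v show "v \<in> cbox 0 1"
        by (auto simp: S_def mem_box_cart)
    qed
    then have "bounded S"
      using bounded_cbox bounded_subset by blast
    moreover have "closed S"
      unfolding S_def by (intro closed_Collect_conj closed_Collect_all closed_Collect_le
          closed_Collect_eq continuous_intros)
    ultimately show ?thesis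
      using compact_eq_bounded_closed by blast
  qed
  moreover have "convex S"
    unfolding convex_def S_def
    by (auto simp: sum.distrib simp flip: sum_distrib_left intro!: add_nonneg_nonneg)
  moreover have "S \<noteq> {}"
  proof -
    have "axis undefined 1 \<in> S"
      by (auto simp: S_def axis_def if_distrib sum.If_cases)
    then show ?thesis by blast
  qed
  moreover have "continuous_on S f"
  proof -
    have "s v \<noteq> 0" if "v \<in> S" for v
      using s[OF that] by auto
    then show ?thesis
      unfolding f_def s_def
      by (intro continuous_intros linear_continuous_on matrix_vector_mul_linear
          linear_conv_bounded_linear[THEN iffD1]) auto
  qed
  moreover have "f \<in> S \<rightarrow> S"
  proof
    fix v assume v: "v \<in> S"
    have "0 \<le> f v $ i" for i
      using s[OF v] Av[OF v, of i] v by (auto simp: f_def S_def)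
    moreover have "(\<Sum>i\<in>UNIV. f v $ i) = 1"
      using s[OF v] by (simp add: f_def s_def flip: sum_divide_distrib)
    ultimately show "f v \<in> S"
      by (simp add: S_def)
  qed
  ultimately obtain v where v: "v \<in> S" "f v = v"
    using brouwer by metis
  have "v + A *v v = s v *\<^sub>R v"
  proof -
    have "s v *\<^sub>R f v = v + A *v v"
      using s[OF v(1)] by (simp add: f_def)
    then show ?thesis
      by (simp add: v(2))
  qed
  then have "A *v v = (s v - 1) *\<^sub>R v"
    by (simp add: algebra_simps)
  moreover have "v \<noteq> 0" "\<forall>i. 0 \<le> v $ i"
    using v(1) by (auto simp: S_def)
  ultimately show ?thesis
    using that[of v "s v - 1"] s[OF v(1)] by auto
qed

text \<open>
  Measure a complex eigenvector \<open>x\<close> by the largest ratio \<open>M = cmod x_m / v_m\<close>.  The \<open>m\<close>-th row of the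
  eigenvalue equation then gives \<open>cmod z * cmod x_m \<le> M * (A v)_m = \<mu> * cmod x_m\<close>.
\<close>

lemma spectral_radius_eq_positive_eigenvalue:
  fixes A :: "real^'d^'d::finite"
  assumes A: "\<And>i k. 0 \<le> A $ i $ k" and v: "\<And>i. 0 < v $ i"
    and "0 \<le> \<mu>" and eig: "A *v v = \<mu> *\<^sub>R v"
  shows "spectral_radius A = \<mu>"
proof -
  have eig_i: "(\<Sum>k\<in>UNIV. A $ i $ k * v $ k) = \<mu> * v $ i" for i
    using arg_cong[OF eig, of "\<lambda>x. x $ i"] by (simp add: matrix_vector_mult_def)
  have bound: "cmod z \<le> \<mu>" if "z \<in> complex_spectrum A" for z
  proof -
    from that obtain x where x: "x \<noteq> 0" "map_matrix complex_of_real A *v x = z *s x"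
      by (auto simp: complex_spectrum_def)
    define M where "M = Max (range (\<lambda>i. cmod (x $ i) / v $ i))"
    have "M \<in> range (\<lambda>i. cmod (x $ i) / v $ i)"
      unfolding M_def by (rule Max_in) auto
    then obtain m where m: "M = cmod (x $ m) / v $ m"
      by blast
    have le: "cmod (x $ i) \<le> M * v $ i" for i
    proof -
      have "cmod (x $ i) / v $ i \<le> M"
        unfolding M_def by (rule Max_ge) auto
      then show ?thesis
        using v[of i] by (simp add: pos_divide_le_eq)
    qed
    obtain l where l: "x $ l \<noteq> 0"
      using x(1) by (auto simp: vec_eq_iff)
    have "0 < M"
      using le[of l] l v[of l] by (smt (verit) mult_nonpos_nonneg norm_le_zero_iff)
    then have xm: "0 < cmod (x $ m)"
      using m v[of m] by (simp add: zero_less_divide_iff)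
    have "z * x $ m = (\<Sum>k\<in>UNIV. complex_of_real (A $ m $ k) * x $ k)"
      using arg_cong[OF x(2), of "\<lambda>x. x $ m"] by (simp add: matrix_vector_mult_def map_matrix_def)
    then have "cmod z * cmod (x $ m) \<le> (\<Sum>k\<in>UNIV. cmod (complex_of_real (A $ m $ k) * x $ k))"
      by (metis norm_mult norm_sum)
    also have "\<dots> \<le> (\<Sum>k\<in>UNIV. A $ m $ k * (M * v $ k))"
      using A le by (intro sum_mono) (simp add: norm_mult mult_left_mono)
    also have "\<dots> = M * (\<Sum>k\<in>UNIV. A $ m $ k * v $ k)"
      by (simp add: sum_distrib_left algebra_simps)
    also have "\<dots> = \<mu> * cmod (x $ m)"
      using m v[of m] by (simp add: eig_i)
    finally show ?thesis
      using xm by simp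
  qed
  have "complex_of_real \<mu> \<in> complex_spectrum A"
  proof -
    have "map_matrix complex_of_real A *v (\<chi> i. complex_of_real (v $ i))
        = complex_of_real \<mu> *s (\<chi> i. complex_of_real (v $ i))"
      by (simp add: vec_eq_iff matrix_vector_mult_def map_matrix_def eig_i flip: of_real_mult of_real_sum)
    moreover have "(\<chi> i. complex_of_real (v $ i)) \<noteq> 0"
      using v by (simp add: vec_eq_iff less_imp_neq[symmetric])
    ultimately show ?thesis
      unfolding complex_spectrum_def by blast
  qed
  then have "\<mu> \<in> cmod ` complex_spectrum A"
    using \<open>0 \<le> \<mu>\<close> by (force simp: image_iff)
  then show ?thesis
    unfolding spectral_radius_def using bound by (intro cSup_eq_maximum) auto
qed

text \<open>
  Primitivity of a nonnegative matrix depends on its zero pattern only.  This is the form needed for a matrix multiplied by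
  positive diagonal matrices on both sides, whose powers are in general not related to the original ones by
  diagonal scaling.
\<close>

lemma primitive_matrix_transfer:
  fixes M N :: "real^'n^'n::finite"
  assumes M: "primitive_matrix M" and N: "\<And>i j. 0 \<le> N $ i $ j"
    and MN: "\<And>i j. 0 < M $ i $ j \<Longrightarrow> 0 < N $ i $ j"
  shows "primitive_matrix N"
proof -
  define P where "P B k = ((**) B ^^ k) (mat 1)" for B :: "real^'n^'n" and k
  have P_Suc: "P B (Suc k) $ i $ j = (\<Sum>l\<in>UNIV. B $ i $ l * P B k $ l $ j)" for B k i j
    by (simp add: P_def matrix_matrix_mult_def)
  have M_nonneg: "0 \<le> M $ i $ j" for i j
    using M by (simp add: primitive_matrix_def)
  have PN: "0 \<le> P N k $ i $ j" for k i j
  proof (induction k arbitrary: i)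
    case (Suc k)
    then show ?case
      using N by (auto simp: P_Suc intro!: sum_nonneg)
  qed (simp add: P_def mat_def)
  have "0 < P M k $ i $ j \<Longrightarrow> 0 < P N k $ i $ j" for k i j
  proof (induction k arbitrary: i)
    case (Suc k)
    have "\<exists>l. 0 < M $ i $ l * P M k $ l $ j"
    proof (rule ccontr)
      assume "\<not> ?thesis"
      then have "(\<Sum>l\<in>UNIV. M $ i $ l * P M k $ l $ j) \<le> 0"
        by (intro sum_nonpos) (auto simp: not_less)
      with Suc.prems show False
        by (simp add: P_Suc)
    qed
    then obtain l where "0 < M $ i $ l" "0 < P M k $ l $ j"
      using M_nonneg by (metis less_eq_real_def mult_eq_0_iff order_less_irrefl zero_less_mult_pos)
    then have "0 < N $ i $ l * P N k $ l $ j"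
      using MN Suc.IH by simp
    also have "\<dots> \<le> (\<Sum>l\<in>UNIV. N $ i $ l * P N k $ l $ j)"
      using N PN by (intro member_le_sum) auto
    finally show ?case
      by (simp add: P_Suc)
  qed (simp add: P_def)
  then show ?thesis
    using M N by (auto simp: primitive_matrix_def P_def)
qed

lemma funpow_matrix_mult_mult_vector:
  fixes M :: "real^'n^'n::finite"
  shows "(((**) M ^^ k) (mat 1)) *v z = (((*v) M) ^^ k) z"
  by (induction k) (auto simp flip: matrix_vector_mul_assoc)

text \<open>
  In logarithmic coordinates, scaling the blocks of a vector is translation by a block-constant vector.
\<close>

definition lift :: "('n::finite \<Rightarrow> 'd::finite) \<Rightarrow> real^'d \<Rightarrow> real^'n" where
  "lift blk \<beta> = (\<chi> j. \<beta> $ blk j)"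

lemma lift_nth [simp]: "lift blk \<beta> $ j = \<beta> $ blk j"
  by (simp add: lift_def)

lemma lift_scaleR: "lift blk (c *\<^sub>R \<beta>) = c *\<^sub>R lift blk \<beta>"
  by (simp add: vec_eq_iff)

text \<open>
  The relation \<open>N (lift \<beta>) = lift (A \<beta>)\<close> says that every entry of \<open>A\<close> is the sum over a block of a row of
  \<open>N\<close>, hence nonnegative.  It also iterates: an eigenvector \<open>v\<close> of \<open>A\<close> satisfies
  \<open>N^\<nu> (lift v) = \<mu>^\<nu> lift v\<close>, and the left-hand side is positive once \<open>N^\<nu>\<close> is, because \<open>lift v\<close> is
  nonnegative and nonzero.  So \<open>v\<close> is positive and \<open>\<mu>\<close> is the spectral radius.
\<close>

lemma quotient_positive_fixed_vector:
  fixes N :: "real^'n^'n::finite" and A :: "real^'d^'d::finite"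
  assumes "surj blk" and N: "primitive_matrix N"
    and quot: "\<And>\<beta>. N *v lift blk \<beta> = lift blk (A *v \<beta>)"
    and rho: "spectral_radius A = 1"
  shows "\<exists>v. (\<forall>i. 0 < v $ i) \<and> A *v v = v"
proof -
  have A_nonneg: "0 \<le> A $ i $ k" for i k
  proof -
    obtain l where "blk l = i"
      using \<open>surj blk\<close> by (metis surjD)
    then have "A $ i $ k = (N *v lift blk (axis k 1)) $ l"
      by (simp add: quot matrix_vector_mult_basis column_def)
    also have "\<dots> \<ge> 0"
      using N unfolding primitive_matrix_def matrix_vector_mult_def
      by (auto simp: axis_def intro!: sum_nonneg)
    finally show ?thesis .
  qed
  then obtain v \<mu> where v: "\<And>i. 0 \<le> v $ i" "v \<noteq> 0" "0 \<le> \<mu>" "A *v v = \<mu> *\<^sub>R v"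
    using nonneg_matrix_eigenvector by blast
  obtain \<nu> where \<nu>: "\<And>i j. 0 < (((**) N ^^ \<nu>) (mat 1)) $ i $ j"
    using N by (auto simp: primitive_matrix_def)
  define P where "P = ((**) N ^^ \<nu>) (mat 1)"
  have "(((*v) N) ^^ k) (lift blk v) = \<mu> ^ k *\<^sub>R lift blk v" for k
    by (induction k) (simp_all add: matrix_vector_mult_scaleR quot v(4) lift_scaleR)
  then have P_v: "P *v lift blk v = \<mu> ^ \<nu> *\<^sub>R lift blk v"
    by (simp add: P_def funpow_matrix_mult_mult_vector)
  have pos: "0 < v $ i" for i
  proof -
    obtain l where l: "blk l = i"
      using \<open>surj blk\<close> by (metis surjD)
    obtain k where "v $ k \<noteq> 0"
      using v(2) by (auto simp: vec_eq_iff)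
    moreover obtain j where j: "blk j = k"
      using \<open>surj blk\<close> by (metis surjD)
    ultimately have "0 < P $ l $ j * lift blk v $ j"
      using v(1)[of k] \<nu> by (simp add: P_def)
    then have "0 < (\<Sum>j\<in>UNIV. P $ l $ j * lift blk v $ j)"
      using v(1) \<nu> by (intro sum_pos2[of _ j]) (auto simp: P_def less_imp_le)
    then have "0 < (P *v lift blk v) $ l"
      by (simp add: matrix_vector_mult_def)
    then have "0 < \<mu> ^ \<nu> * v $ i"
      by (simp add: P_v l)
    then show ?thesis
      using v(1)[of i] by (simp add: zero_less_mult_iff)
  qed
  then have "\<mu> = 1"
    using spectral_radius_eq_positive_eigenvalue[OF A_nonneg _ v(3,4)] rho by simp
  then show ?thesis
    using pos v(4) by auto
qed

section \<open>Logarithmic coordinates around a positive vector\<close>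

definition exp_coord :: "real^'n::finite \<Rightarrow> real^'n \<Rightarrow> real^'n" where
  "exp_coord u z = (\<chi> j. u $ j * exp (z $ j))"

lemma exp_coord_K_pplus: "u \<in> K_pplus \<Longrightarrow> exp_coord u z \<in> K_pplus"
  by (simp add: exp_coord_def K_pplus_def)

lemma exp_coord_0 [simp]: "exp_coord u 0 = u"
  by (simp add: exp_coord_def vec_eq_iff)

lemma exp_coord_add_lift:
  "exp_coord u (z + lift blk \<beta>) = block_scale blk (\<chi> i. exp (\<beta> $ i)) (exp_coord u z)"
  by (simp add: exp_coord_def block_scale_def vec_eq_iff exp_add)

lemma exp_coord_surj_K_pplus:
  assumes "u \<in> K_pplus" "x \<in> K_pplus"
  obtains z where "x = exp_coord u z"
proof
  show "x = exp_coord u (\<chi> j. ln (x $ j / u $ j))"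
    using assms by (simp add: exp_coord_def K_pplus_def vec_eq_iff less_imp_neq[symmetric])
qed

lemma continuous_exp_coord: "continuous_on UNIV (exp_coord u)"
  unfolding exp_coord_def by (intro continuous_intros)

lemma exp_coord_mono: "u \<in> K_pplus \<Longrightarrow> z \<le> z' \<Longrightarrow> exp_coord u z \<le> exp_coord u z'"
  by (simp add: exp_coord_def K_pplus_def less_eq_vec_def mult_left_mono less_imp_le)

lemma vec_powr_pos: "(\<And>i. 0 < \<alpha> $ i) \<Longrightarrow> 0 < vec_powr \<alpha> B $ i"
  by (simp add: vec_powr_def prod_pos less_imp_neq[symmetric])

lemma vec_powr_exp:
  "vec_powr (\<chi> i. exp (\<beta> $ i)) B = (\<chi> i. exp ((B *v \<beta>) $ i))"
  by (simp add: vec_powr_def vec_eq_iff matrix_vector_mult_def powr_def exp_sum)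

text \<open>
  The part of the class \<open>H_class\<close> that is visible on the open cone.  On the boundary the logarithm is not
  available, and orbits that start in the open cone never reach it.
\<close>

locale positive_mh_map =
  fixes blk :: "'n::finite \<Rightarrow> 'd::finite" and F :: "real^'n \<Rightarrow> real^'n" and A :: "real^'d^'d"
    and u :: "real^'n"
  assumes F_pos: "x \<in> K_pplus \<Longrightarrow> F x \<in> K_pplus"
    and F_mono: "\<lbrakk>x \<in> K_pplus; y \<in> K_pplus; x \<le> y\<rbrakk> \<Longrightarrow> F x \<le> F y"
    and F_cont: "continuous_on K_pplus F"
    and F_hom: "\<lbrakk>x \<in> K_pplus; \<And>i. 0 < \<alpha> $ i\<rbrakk>
      \<Longrightarrow> F (block_scale blk \<alpha> x) = block_scale blk (vec_powr \<alpha> A) (F x)"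
    and u_pos: "u \<in> K_pplus"
begin

definition log_map :: "real^'n \<Rightarrow> real^'n" where
  "log_map z = (\<chi> j. ln (F (exp_coord u z) $ j / F u $ j))"

lemma F_exp_pos: "0 < F (exp_coord u z) $ j" "0 < F u $ j"
  using F_pos[OF exp_coord_K_pplus[OF u_pos]] F_pos[OF u_pos] by (simp_all add: K_pplus_def)

lemma F_exp_coord: "F (exp_coord u z) = exp_coord (F u) (log_map z)"
  using F_exp_pos by (simp add: log_map_def exp_coord_def[of "F u"] vec_eq_iff
      less_imp_neq[symmetric])

lemma log_map_0: "log_map 0 = 0"
  using F_exp_pos(2) by (simp add: log_map_def vec_eq_iff less_imp_neq[symmetric])

lemma log_map_add_lift: "log_map (z + lift blk \<beta>) = log_map z + lift blk (A *v \<beta>)"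
proof -
  have "F (exp_coord u (z + lift blk \<beta>)) $ j
      = exp ((A *v \<beta>) $ blk j) * F (exp_coord u z) $ j" for j
    using F_hom[OF exp_coord_K_pplus[OF u_pos], of "\<chi> i. exp (\<beta> $ i)" z]
    by (simp add: exp_coord_add_lift vec_powr_exp block_scale_def)
  then show ?thesis
    using F_exp_pos by (simp add: log_map_def vec_eq_iff ln_mult ln_div less_imp_neq[symmetric])
qed

lemma mono_log_map: "mono log_map"
proof
  fix z z' :: "real^'n" assume "z \<le> z'"
  then have "F (exp_coord u z) \<le> F (exp_coord u z')"
    by (intro F_mono exp_coord_K_pplus exp_coord_mono u_pos)
  then show "log_map z \<le> log_map z'"
    using F_exp_pos by (simp add: log_map_def less_eq_vec_def divide_right_mono less_imp_le)
qed

lemma continuous_log_map: "continuous_on UNIV log_map"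
proof -
  have "continuous_on UNIV (\<lambda>z. F (exp_coord u z))"
    by (rule continuous_on_compose2[OF F_cont continuous_exp_coord])
      (auto intro: exp_coord_K_pplus u_pos)
  then have "continuous_on UNIV (\<lambda>z. F (exp_coord u z) $ j / F u $ j)" for j
    using F_exp_pos(2) by (intro continuous_intros) (auto simp: less_imp_neq[symmetric])
  then show ?thesis
    unfolding log_map_def using F_exp_pos
    by (intro continuous_on_vec_lambda continuous_on_ln) (auto simp: less_imp_neq[symmetric])
qed

lemma log_map_has_derivative:
  assumes "(F has_derivative D) (at u)"
  shows "(log_map has_derivative (\<lambda>z. \<chi> j. D (\<chi> l. u $ l * z $ l) $ j / F u $ j)) (at 0)"
proof -
  have "((\<lambda>z. exp_coord u z $ l) has_derivative (\<lambda>z. u $ l * z $ l)) (at 0)" for l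
    unfolding exp_coord_def by (auto intro!: derivative_eq_intros
        bounded_linear.has_derivative[OF bounded_linear_vec_nth])
  then have e: "(exp_coord u has_derivative (\<lambda>z. \<chi> l. u $ l * z $ l)) (at 0)"
    by (subst has_derivative_componentwise_within)
      (auto simp: Basis_vec_def cart_eq_inner_axis[symmetric])
  have "((\<lambda>z. F (exp_coord u z)) has_derivative (\<lambda>z. D (\<chi> l. u $ l * z $ l))) (at 0)"
    using has_derivative_compose[OF e] assms by simp
  then have Fj: "((\<lambda>z. F (exp_coord u z) $ j) has_derivative (\<lambda>z. D (\<chi> l. u $ l * z $ l) $ j)) (at 0)"
    for j
    by (rule bounded_linear.has_derivative[OF bounded_linear_vec_nth])
  have "((\<lambda>z. ln (F (exp_coord u z) $ j / F u $ j))
      has_derivative (\<lambda>z. D (\<chi> l. u $ l * z $ l) $ j / F u $ j)) (at 0)" for j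
    using F_exp_pos(2)[of j] by (auto intro!: derivative_eq_intros Fj simp: field_simps)
  then show ?thesis
    by (subst has_derivative_componentwise_within)
      (auto simp: Basis_vec_def cart_eq_inner_axis[symmetric] log_map_def)
qed

text \<open>
  Along the ray spanned by \<open>lift blk \<beta>\<close> the map is linear by homogeneity, with values
  \<open>h *\<^sub>R lift blk (A *v \<beta>)\<close>; uniqueness of the derivative does the rest.
\<close>

lemma log_map_derivative_lift:
  assumes L: "(log_map has_derivative L) (at 0)"
  shows "L (lift blk \<beta>) = lift blk (A *v \<beta>)"
proof -
  have "((\<lambda>h::real. h *\<^sub>R lift blk \<beta>) has_derivative (\<lambda>h. h *\<^sub>R lift blk \<beta>)) (at 0)"
    by (rule bounded_linear_imp_has_derivative[OF bounded_linear_scaleR_left])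
  moreover have "(log_map has_derivative L) (at ((0::real) *\<^sub>R lift blk \<beta>))"
    using L by simp
  ultimately have "((\<lambda>h. log_map (h *\<^sub>R lift blk \<beta>)) has_derivative (\<lambda>h. L (h *\<^sub>R lift blk \<beta>)))
      (at (0::real))"
    by (rule has_derivative_compose)
  moreover have "(\<lambda>h. log_map (h *\<^sub>R lift blk \<beta>)) = (\<lambda>h. h *\<^sub>R lift blk (A *v \<beta>))"
    using log_map_add_lift[of 0] log_map_0
    by (simp add: fun_eq_iff matrix_vector_mult_scaleR flip: lift_scaleR)
  moreover have "((\<lambda>h::real. h *\<^sub>R lift blk (A *v \<beta>)) has_derivative (\<lambda>h. h *\<^sub>R lift blk (A *v \<beta>)))
      (at 0)"
    by (rule bounded_linear_imp_has_derivative[OF bounded_linear_scaleR_left])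
  ultimately have "(\<lambda>h::real. L (h *\<^sub>R lift blk \<beta>)) = (\<lambda>h. h *\<^sub>R lift blk (A *v \<beta>))"
    using has_derivative_unique by metis
  then show ?thesis
    by (metis scaleR_one)
qed

end

section \<open>Normalization of the blocks\<close>

lemma block_block_scale: "block blk i (block_scale blk c x) = c $ i *\<^sub>R block blk i x"
  by (simp add: block_def block_scale_def vec_eq_iff)

lemma block_in_block_space: "block blk i x \<in> block_space blk i"
  by (simp add: block_def block_space_def)

lemma block_norm_scaleR:
  "norm_on (block_space blk i) N \<Longrightarrow> N (c *\<^sub>R block blk i x) = \<bar>c\<bar> * N (block blk i x)"
  using block_in_block_space[of blk i x] by (simp add: norm_on_def)

lemma block_nonzero:
  assumes "surj blk" "x \<in> K_pplus"
  shows "block blk i x \<noteq> 0"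
proof -
  obtain j where "blk j = i"
    using assms(1) by (metis surjD)
  then have "block blk i x $ j \<noteq> 0"
    using assms(2) by (simp add: block_def K_pplus_def less_imp_neq[symmetric])
  then show ?thesis
    by (metis zero_index)
qed

text \<open>
  Normalization is itself a block scaling, so it is absorbed by multi-homogeneity.
\<close>

lemma block_normalize_alt:
  "block_normalize blk \<gamma> x = block_scale blk (\<chi> i. 1 / \<gamma> i (block blk i x)) x"
  by (simp add: block_normalize_def block_scale_def vec_eq_iff)

lemma block_norm_pos:
  assumes "surj blk" "norm_on (block_space blk i) N" "x \<in> K_pplus"
  shows "0 < N (block blk i x)"
  using assms block_nonzero[OF assms(1,3)] block_in_block_space
  unfolding norm_on_def by (metis less_eq_real_def)

lemma block_normalize_block_scale:
  assumes "\<And>i. norm_on (block_space blk i) (\<gamma> i)" and "\<And>i. 0 < c $ i"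
  shows "block_normalize blk \<gamma> (block_scale blk c x) = block_normalize blk \<gamma> x"
proof -
  have "\<gamma> i (block blk i (block_scale blk c x)) = c $ i * \<gamma> i (block blk i x)" for i
    using assms(2)[of i] by (simp add: block_block_scale block_norm_scaleR[OF assms(1)])
  then show ?thesis
    using assms(2) by (simp add: block_normalize_alt vec_eq_iff)
      (simp add: block_scale_def less_imp_neq[symmetric])
qed

lemma block_normalize_S_pplus: "x \<in> S_pplus blk \<gamma> \<Longrightarrow> block_normalize blk \<gamma> x = x"
  by (simp add: block_normalize_def S_pplus_def vec_eq_iff)

lemma block_normalize_in_S_pplus:
  assumes "surj blk" and \<gamma>: "\<And>i. norm_on (block_space blk i) (\<gamma> i)" and x: "x \<in> K_pplus"
  shows "block_normalize blk \<gamma> x \<in> S_pplus blk \<gamma>"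
proof -
  have pos: "0 < \<gamma> i (block blk i x)" for i
    by (rule block_norm_pos[OF assms(1) \<gamma> x])
  have "\<gamma> i (block blk i (block_normalize blk \<gamma> x)) = 1" for i
    using pos[of i] by (simp add: block_normalize_alt block_block_scale block_norm_scaleR[OF \<gamma>])
  then show ?thesis
    using x pos by (simp add: S_pplus_def K_pplus_def block_normalize_def)
qed

lemma continuous_block_norm:
  assumes N: "norm_on (block_space blk i) N"
  shows "continuous_on UNIV (\<lambda>x. N (block blk i x))"
proof (rule convex_on_continuous)
  show "convex_on UNIV (\<lambda>x. N (block blk i x))"
  proof (intro convex_onI)
    fix t :: real and x y :: "real^'a"
    assume t: "0 < t" "t < 1"
    have scale: "N (c *\<^sub>R block blk i x) = \<bar>c\<bar> * N (block blk i x)" for c x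
      by (rule block_norm_scaleR[OF N])
    have mem: "c *\<^sub>R block blk i x \<in> block_space blk i" for c x
      by (simp add: block_def block_space_def)
    have "block blk i ((1 - t) *\<^sub>R x + t *\<^sub>R y) = (1 - t) *\<^sub>R block blk i x + t *\<^sub>R block blk i y"
      by (simp add: block_def vec_eq_iff)
    then have "N (block blk i ((1 - t) *\<^sub>R x + t *\<^sub>R y))
        \<le> N ((1 - t) *\<^sub>R block blk i x) + N (t *\<^sub>R block blk i y)"
      using N mem by (simp add: norm_on_def)
    then show "N (block blk i ((1 - t) *\<^sub>R x + t *\<^sub>R y))
        \<le> (1 - t) * N (block blk i x) + t * N (block blk i y)"
      using t by (simp add: scale)
  qed simp
qed simp

lemma tendsto_block_normalize:
  assumes "surj blk" and \<gamma>: "\<And>i. norm_on (block_space blk i) (\<gamma> i)"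
    and "x \<in> K_pplus" and f: "(f \<longlongrightarrow> x) net"
  shows "((\<lambda>k. block_normalize blk \<gamma> (f k)) \<longlongrightarrow> block_normalize blk \<gamma> x) net"
proof -
  have "((\<lambda>k. \<gamma> i (block blk i (f k))) \<longlongrightarrow> \<gamma> i (block blk i x)) net" for i
    using continuous_on_tendsto_compose[OF continuous_block_norm[OF \<gamma>] f] by simp
  then show ?thesis
    unfolding block_normalize_def
    using f less_imp_neq[OF block_norm_pos[OF assms(1) \<gamma> assms(3)], symmetric]
    by (intro tendsto_intros) simp_all
qed

section \<open>Convergence to the eigenvector and its uniqueness\<close>

text \<open>
  A positive \<open>x\<close> dominates a multiple \<open>c\<close> of the vector of ones, and \<open>F\<close> maps this multiple to a positive
  block scaling of \<open>F 1\<close>.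
\<close>

lemma H_class_K_pplus:
  assumes F: "F \<in> H_class blk" and hom: "multi_homogeneous blk F A" and x: "x \<in> K_pplus"
  shows "F x \<in> K_pplus"
proof -
  define c where "c = Min (range (\<lambda>j. x $ j))"
  have "c \<in> range (\<lambda>j. x $ j)"
    unfolding c_def by (rule Min_in) auto
  then have c: "0 < c"
    using x by (auto simp: K_pplus_def)
  have "c \<le> x $ j" for j
    by (simp add: c_def)
  then have "F (block_scale blk (\<chi> i. c) 1) \<le> F x"
    using F c x by (auto simp: H_class_def K_plus_def K_pplus_def block_scale_def less_eq_vec_def
        less_imp_le)
  moreover have "F (block_scale blk (\<chi> i. c) 1) = block_scale blk (vec_powr (\<chi> i. c) A) (F 1)"
    using hom c by (simp add: multi_homogeneous_def K_plus_def)
  moreover have "0 < vec_powr (\<chi> i::'b. c) A $ i" for i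
    using c by (simp add: vec_powr_pos)
  moreover have "0 < F 1 $ j" for j
    using F by (simp add: H_class_def K_pplus_def)
  ultimately have "0 < block_scale blk (vec_powr (\<chi> i. c) A) (F 1) $ j"
    "block_scale blk (vec_powr (\<chi> i. c) A) (F 1) $ j \<le> F x $ j" for j
    by (simp_all add: block_scale_def less_eq_vec_def)
  then show ?thesis
    unfolding K_pplus_def using less_le_trans by blast
qed

theorem theorem5p1:
  fixes blk :: "'n::finite \<Rightarrow> 'd::finite"
    and \<gamma> :: "'d \<Rightarrow> real^'n \<Rightarrow> real"
    and F :: "real^'n \<Rightarrow> real^'n"
    and A :: "real^'d^'d"
    and lam :: "real^'d"
    and u x0 :: "real^'n"
    and x :: "nat \<Rightarrow> real^'n"
  assumes "surj blk"
    and "\<And>i. monotonic_norm_on (block_space blk i) (\<gamma> i)"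
    and "F \<in> H_class blk"
    and "x0 \<in> S_pplus blk \<gamma>"
    and "multi_homogeneous blk F A"
    and "spectral_radius A = 1"
    and "\<And>i. 0 < lam $ i"
    and "u \<in> S_pplus blk \<gamma>"
    and "F u = block_scale blk lam u"
    and "F differentiable (at u)"
    and "primitive_matrix (jacobian F (at u))"
    and "x 0 = x0"
    and "\<And>k. x (Suc k) = block_normalize blk \<gamma> (F (x k))"
  shows "mh_eigenvector blk F u
    \<and> (\<forall>y\<in>S_pplus blk \<gamma>. mh_eigenvector blk F y \<longrightarrow> y = u)
    \<and> (\<forall>k. x k \<in> S_pplus blk \<gamma>)
    \<and> x \<longlonglongrightarrow> u"
proof -
  note surj = assms(1) and F = assms(3) and hom = assms(5) and rho = assms(6) and lam = assms(7)
    and u = assms(8) and eig = assms(9) and prim = assms(11)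
  have \<gamma>: "norm_on (block_space blk i) (\<gamma> i)" for i
    using assms(2)[of i] by (simp add: monotonic_norm_on_def)
  have u_pos: "u \<in> K_pplus"
    using u by (simp add: S_pplus_def)
  have pplus_plus: "(K_pplus :: (real^'n) set) \<subseteq> K_plus"
    by (auto simp: K_pplus_def K_plus_def less_imp_le)
  interpret positive_mh_map blk F A u
  proof
    show "F x \<in> K_pplus" if "x \<in> K_pplus" for x
      using H_class_K_pplus[OF F hom that] .
    show "F x \<le> F y" if "x \<in> K_pplus" "y \<in> K_pplus" "x \<le> y" for x y
      using F that subsetD[OF pplus_plus] by (simp add: H_class_def)
    show "continuous_on K_pplus F"
      using F by (auto simp: H_class_def intro: continuous_on_subset[OF _ pplus_plus])
    show "F (block_scale blk \<alpha> x) = block_scale blk (vec_powr \<alpha> A) (F x)"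
      if "x \<in> K_pplus" "\<And>i. 0 < \<alpha> $ i" for x \<alpha>
      using hom that subsetD[OF pplus_plus] by (simp add: multi_homogeneous_def)
  qed (rule u_pos)

  define M where "M = jacobian F (at u)"
  \<comment> \<open>The Jacobian in logarithmic coordinates.\<close>
  define N where "N = (\<chi> i j. M $ i $ j * u $ j / F u $ i)"
  have u_nth: "0 < u $ j" for j
    using u_pos by (simp add: K_pplus_def)
  have "(F has_derivative (*v) M) (at u)"
    using assms(10) jacobian_works by (metis M_def)
  from log_map_has_derivative[OF this]
  have deriv: "(log_map has_derivative (*v) N) (at 0)"
    by (rule has_derivative_eq_rhs)
      (simp add: fun_eq_iff vec_eq_iff matrix_vector_mult_def N_def sum_divide_distrib mult.assoc)
  have N_prim: "primitive_matrix N"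
  proof (rule primitive_matrix_transfer)
    show "primitive_matrix M"
      using prim by (simp add: M_def)
    then show "0 \<le> N $ i $ j" for i j
      using u_nth F_exp_pos(2) by (simp add: N_def primitive_matrix_def less_imp_le)
    show "0 < N $ i $ j" if "0 < M $ i $ j" for i j
      using that u_nth F_exp_pos(2) by (simp add: N_def)
  qed
  obtain v where v: "\<And>i. 0 < v $ i" "A *v v = v"
    using quotient_positive_fixed_vector[OF surj N_prim log_map_derivative_lift[OF deriv] rho] by blast
  obtain \<nu> where "\<And>i j. 0 < (((**) N ^^ \<nu>) (mat 1)) $ i $ j"
    using N_prim by (auto simp: primitive_matrix_def)
  then have N_pow: "0 < (((*v) N) ^^ \<nu>) (axis j 1) $ i" for i j
    by (simp add: matrix_vector_mult_basis column_def flip: funpow_matrix_mult_mult_vector)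
  have log_map_hom: "log_map (z + c *\<^sub>R lift blk v) = log_map z + c *\<^sub>R lift blk v" for z c
    using log_map_add_lift[of z "c *\<^sub>R v"] by (simp add: lift_scaleR matrix_vector_mult_scaleR v(2))

  have Nu: "block_normalize blk \<gamma> u = u"
    by (rule block_normalize_S_pplus[OF u])
  have F_e: "F (exp_coord u z) = block_scale blk lam (exp_coord u (log_map z))" for z
    unfolding F_exp_coord by (simp add: eig exp_coord_def block_scale_def vec_eq_iff)

  \<comment> \<open>Stated for an arbitrary orbit, because uniqueness applies it to constant orbits.\<close>
  have converge: "(\<forall>k. X k \<in> S_pplus blk \<gamma>) \<and> X \<longlonglongrightarrow> u"
    if X0: "X 0 \<in> S_pplus blk \<gamma>" and X_Suc: "\<And>k. X (Suc k) = block_normalize blk \<gamma> (F (X k))" for X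
  proof -
    obtain z where z: "X 0 = exp_coord u z"
      using exp_coord_surj_K_pplus[OF u_pos] X0 by (auto simp: S_pplus_def)
    have X_eq: "X k = block_normalize blk \<gamma> (exp_coord u ((log_map ^^ k) z))" for k
    proof (induction k)
      case 0
      show ?case
        using block_normalize_S_pplus[OF X0] z by simp
    next
      case (Suc k)
      define y where "y = exp_coord u ((log_map ^^ k) z)"
      have y: "y \<in> K_pplus"
        unfolding y_def by (rule exp_coord_K_pplus[OF u_pos])
      \<comment> \<open>The factors by which the blocks of \<open>y\<close> are scaled when it is normalized; \<open>F\<close> turns them
        into other positive factors, which the next normalization removes.\<close>
      define c where "c = (\<chi> i. 1 / \<gamma> i (block blk i y))"
      have c: "0 < c $ i" for i
        using block_norm_pos[OF surj \<gamma> y] by (simp add: c_def)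
      have "X (Suc k) = block_normalize blk \<gamma> (F (block_scale blk c y))"
        by (simp add: X_Suc Suc.IH y_def c_def flip: block_normalize_alt)
      also have "\<dots> = block_normalize blk \<gamma> (F y)"
        unfolding F_hom[OF y c] by (rule block_normalize_block_scale[OF \<gamma> vec_powr_pos[OF c]])
      also have "\<dots> = block_normalize blk \<gamma> (exp_coord u ((log_map ^^ Suc k) z))"
        unfolding y_def F_e block_normalize_block_scale[OF \<gamma> lam] by simp
      finally show ?case .
    qed
    obtain c where c: "(\<lambda>k. (log_map ^^ k) z) \<longlonglongrightarrow> c *\<^sub>R lift blk v"
      using topical_iterates_converge[OF _ mono_log_map log_map_hom log_map_0 continuous_log_map
          deriv N_pow] v(1) by auto
    have "(\<lambda>k. exp_coord u ((log_map ^^ k) z)) \<longlonglongrightarrow> exp_coord u (c *\<^sub>R lift blk v)"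
      using continuous_on_tendsto_compose[OF continuous_exp_coord c] by simp
    then have "X \<longlonglongrightarrow> block_normalize blk \<gamma> (exp_coord u (c *\<^sub>R lift blk v))"
      unfolding X_eq[abs_def]
      by (rule tendsto_block_normalize[OF surj \<gamma> exp_coord_K_pplus[OF u_pos]])
    moreover have "block_normalize blk \<gamma> (exp_coord u (c *\<^sub>R lift blk v)) = u"
      using exp_coord_add_lift[of u 0 blk "c *\<^sub>R v"] Nu
      by (simp add: lift_scaleR block_normalize_block_scale[OF \<gamma>])
    moreover have "X k \<in> S_pplus blk \<gamma>" for k
      unfolding X_eq by (intro block_normalize_in_S_pplus surj \<gamma> exp_coord_K_pplus u_pos)
    ultimately show ?thesis
      by simp
  qed

  have "mh_eigenvector blk F u"
    using u_pos pplus_plus eig block_nonzero[OF surj u_pos] by (auto simp: mh_eigenvector_def)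
  moreover have "y = u" if y: "y \<in> S_pplus blk \<gamma>" and y_eig: "mh_eigenvector blk F y" for y
  proof -
    have y_pos: "y \<in> K_pplus"
      using y by (simp add: S_pplus_def)
    obtain \<theta> where \<theta>: "F y = block_scale blk \<theta> y"
      using y_eig by (auto simp: mh_eigenvector_def)
    have "0 < \<theta> $ i" for i
    proof -
      obtain j where "blk j = i"
        using surj by (metis surjD)
      then show ?thesis
        using F_pos[OF y_pos] y_pos unfolding \<theta>
        by (auto simp: K_pplus_def block_scale_def dest!: spec[of _ j] simp: zero_less_mult_iff)
    qed
    then have "block_normalize blk \<gamma> (F y) = y"
      by (simp add: \<theta> block_normalize_block_scale[OF \<gamma>] block_normalize_S_pplus[OF y])
    then have "(\<lambda>_::nat. y) \<longlonglongrightarrow> u"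
      using converge[of "\<lambda>_. y"] y by simp
    then show ?thesis
      by (simp add: LIMSEQ_const_iff)
  qed
  moreover have "(\<forall>k. x k \<in> S_pplus blk \<gamma>) \<and> x \<longlonglongrightarrow> u"
    using converge assms(4,12,13) by simp
  ultimately show ?thesis
    by blast
qed

end
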